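(* Let $u_1,\dots,u_{24}$ be the normalised roots of $D_4$ and let $\mathcal{V}=\bigcap_{i=1}^{24}\{x\in\mathbb{R}^4:\langle x,u_i\rangle\le1\}$. Let $D\subseteq\{1,\dots,24\}$, and let $w_i=u_i$ for $i\notin D$ and $w_j=\cos\varphi_j\,u_j+\sin\varphi_j\,\eta_j$ for $j\in D$, where $\varphi_j$ is a real angle (the tilt) and $\eta_j$ is a unit vector orthogonal to $u_j$ (the deviation direction). Put $$V_c=\bigcap_{i=1}^{24}\{\langle x,w_i\rangle\le1\},\qquad C_j=\mathcal{V}\cap\{\langle x,w_j\rangle\ge1\},\qquad E_j=V_c\cap\{\langle x,u_j\rangle\ge1\}\quad(j\in D).$$ Then for every $D$ and every choice of tilts and deviation directions, $$\mathrm{vol}(V_c)=\mathrm{vol}(\mathcal{V})-\mathrm{vol}\Bigl(\bigcup_{j\in D}C_j\Bigr)+\mathrm{vol}\Bigl(\bigcup_{j\in D}E_j\Bigr).$$ In particular $\mathrm{vol}(V_c)\ge8$ if and only if $\mathrm{vol}\bigl(\bigcup_{j\in D}E_j\bigr)\ge\mathrm{vol}\bigl(\bigcup_{j\in D}C_j\bigr)$.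
   Context: The roots of $D_4$ are the $24$ vectors $\pm e_i\pm e_j$, $1\le i<j\le4$, in $\mathbb{R}^4$, and the normalised roots are these divided by $\sqrt2$. The polytope $\mathcal{V}$ (the reference cell) is a regular $24$-cell of volume $8$. Volumes take values in $[0,\infty]$. The set $V_c$ is the Voronoi cell of a centre (placed at the origin) whose $24$ active neighbours lie at $2w_1,\dots,2w_{24}$. *)

theory Defs
  imports "HOL-Analysis.Analysis"
begin

text \<open>Swapping \<open>i\<close> and \<open>j\<close> swaps the two independent signs, so ranging over \<open>i \<noteq> j\<close> gives the
  same set as ranging over \<open>i < j\<close>, without using the ordering of the index type \<open>4\<close>
  (in which \<open>4 = 0\<close>).\<close>

definition D4_roots :: "(real ^ 4) set" where
  "D4_roots = {s *\<^sub>R axis i 1 + t *\<^sub>R axis j 1 | (i::4) (j::4) (s::real) (t::real).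
     i \<noteq> j \<and> s \<in> {-1, 1} \<and> t \<in> {-1, 1}}"

definition D4_normalised_roots :: "(real ^ 4) set" where
  "D4_normalised_roots = (\<lambda>r. (1 / sqrt 2) *\<^sub>R r) ` D4_roots"

definition tilted ::
  "(nat \<Rightarrow> real ^ 4) \<Rightarrow> nat set \<Rightarrow> (nat \<Rightarrow> real) \<Rightarrow> (nat \<Rightarrow> real ^ 4) \<Rightarrow> nat \<Rightarrow> real ^ 4" where
  "tilted u D \<phi> \<eta> i =
     (if i \<in> D then cos (\<phi> i) *\<^sub>R u i + sin (\<phi> i) *\<^sub>R \<eta> i else u i)"

text \<open>\<open>cell u\<close> is the reference cell \<open>\<V>\<close> when \<open>u\<close> enumerates the normalised roots, and
  \<open>cell w\<close> is the Voronoi cell \<open>V\<^sub>c\<close> of the origin with neighbours at \<open>2 w\<^sub>i\<close>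
  when \<open>w\<close> is the family of tilted vectors.\<close>

definition cell :: "(nat \<Rightarrow> real ^ 4) \<Rightarrow> (real ^ 4) set" where
  "cell v = (\<Inter>i\<in>{1..24}. {x. x \<bullet> v i \<le> 1})"

text \<open>With \<open>v = u\<close>, \<open>a = w j\<close> this is \<open>C\<^sub>j\<close>; with \<open>v = w\<close>, \<open>a = u j\<close> it is \<open>E\<^sub>j\<close>.\<close>

definition cap :: "(nat \<Rightarrow> real ^ 4) \<Rightarrow> real ^ 4 \<Rightarrow> (real ^ 4) set" where
  "cap v a = cell v \<inter> {x. x \<bullet> a \<ge> 1}"

text \<open>Values lie in \<open>[0,\<infinity>]\<close>, where subtraction is truncated. The only subtrahend used is the
  volume of a subset of the bounded cell \<open>\<V>\<close>, subtracted from that of \<open>\<V>\<close>, so truncation never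
  takes effect.\<close>

abbreviation vol :: "(real ^ 4) set \<Rightarrow> ennreal" where
  "vol S \<equiv> emeasure lborel S"

end

theory Submission
  imports Defs
begin

text \<open>Exchanging the half-spaces \<open>u\<^sub>j\<close> for \<open>w\<^sub>j\<close> (\<open>j \<in> D\<close>) splits \<open>\<V>\<close>, up to null sets, into
  \<open>\<V> \<inter> V\<^sub>c\<close> and the union of the \<open>C\<^sub>j\<close>, and symmetrically \<open>V\<^sub>c\<close> into \<open>\<V> \<inter> V\<^sub>c\<close> and the union of
  the \<open>E\<^sub>j\<close>; since \<open>\<V>\<close> has finite volume, the common part can be cancelled.

  For the value \<open>8\<close>: \<open>\<V>\<close> is given by \<open>\<bar>x\<^sub>i\<bar> + \<bar>x\<^sub>j\<bar> \<le> 2 c\<close> for \<open>i \<noteq> j\<close>, with \<open>c = 1 / \<surd>2\<close>. Cut the cube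
  \<open>[-c, c]\<^sup>4\<close> into the eight pyramids with apex \<open>0\<close> over its facets and reflect each of them in its
  facet. The cube and the reflected pyramids tile \<open>\<V>\<close>, so \<open>\<V>\<close> has twice the volume \<open>(2 c)\<^sup>4 = 4\<close>
  of the cube.\<close>

section \<open>Exchange of half-spaces between two cells\<close>

lemma closed_cell: "closed (cell v)"
  unfolding cell_def by (intro closed_INT ballI closed_Collect_le continuous_intros)

text \<open>Constraints with index outside \<open>D\<close> are shared, so a point of
  \<open>cell v\<close> can leave \<open>cell w\<close> only through some \<open>w j\<close> with
  \<open>j \<in> D\<close>. The additive form remains valid when \<open>cell v\<close> has infinite
  volume, which allows the application with the two families interchanged.\<close>

lemma emeasure_cell_split:
  assumes "D \<subseteq> {1..24}" and "\<And>i. i \<in> {1..24} - D \<Longrightarrow> v i = w i"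
  shows "vol (cell v) = vol (cell v \<inter> cell w) + vol (\<Union>j\<in>D. cap v (w j))"
proof -
  let ?U = "\<Union>j\<in>D. cap v (w j)" and ?H = "\<Union>j\<in>D. {x. w j \<bullet> x = 1}"
  have fin: "finite D"
    using assms(1) finite_subset by blast
  have cap: "closed (cap a b)" for a b
    unfolding cap_def by (intro closed_Int closed_cell closed_Collect_le continuous_intros)
  have meas: "cell v \<in> sets borel" "cell w \<in> sets borel" "?U \<in> sets borel"
    using closed_cell cap fin by (auto intro!: borel_closed)
  have "negligible ?H"
    using fin by (intro negligible_Union) (auto intro: negligible_hyperplane)
  moreover have "?H \<in> sets borel"
    using fin by (intro sets.finite_UN borel_closed closed_hyperplane)
  ultimately have null: "?H \<in> null_sets lborel"
    by (simp add: negligible_iff_null_sets null_sets_completion_iff)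
  \<comment> \<open>Leaving \<open>cell w\<close> means a strict inequality while caps are closed;
    the two differ only on the bounding hyperplanes collected in \<open>?H\<close>.\<close>
  have eq: "cell v - cell w - ?H = ?U - ?H"
  proof -
    have "x \<in> cell v - cell w \<longleftrightarrow> x \<in> ?U" if "x \<notin> ?H" for x
    proof -
      have "\<not> x \<bullet> w j \<le> 1 \<longleftrightarrow> x \<bullet> w j \<ge> 1" if "j \<in> D" for j
        using \<open>x \<notin> ?H\<close> that by (auto simp: inner_commute order_le_less)
      moreover have "x \<in> cell w \<longleftrightarrow> (\<forall>j\<in>D. x \<bullet> w j \<le> 1)" if "x \<in> cell v"
      proof
        assume D: "\<forall>j\<in>D. x \<bullet> w j \<le> 1"
        have "x \<bullet> w i \<le> 1" if "i \<in> {1..24}" for i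
          using D assms(2)[of i] that \<open>x \<in> cell v\<close> by (cases "i \<in> D") (force simp: cell_def)+
        then show "x \<in> cell w"
          by (simp add: cell_def)
      qed (use assms(1) in \<open>auto simp: cell_def\<close>)
      ultimately show ?thesis
        unfolding cap_def by blast
    qed
    then show ?thesis
      by blast
  qed
  have "vol (cell v) = vol (cell v \<inter> cell w) + vol (cell v - cell w)"
    using meas by (subst plus_emeasure) (auto simp: Int_Diff_Un)
  also have "vol (cell v - cell w) = vol (cell v - cell w - ?H)"
    using meas null by (intro emeasure_Diff_null_set[symmetric]) auto
  also have "\<dots> = vol ?U"
    unfolding eq using meas null by (intro emeasure_Diff_null_set) auto
  finally show ?thesis .
qed

section \<open>Decomposition of the cube into pyramids and of the larger body into cube and
  caps\<close>

text \<open>The pair \<open>(i, s)\<close> stands for the facet \<open>s x\<^sub>i = c\<close> of the cube \<open>[-c, c]\<^sup>n\<close>.\<close>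

definition facets :: "('n::finite \<times> real) set" where
  "facets = UNIV \<times> {-1, 1}"

definition facet_pyramid :: "real \<Rightarrow> 'n::finite \<times> real \<Rightarrow> (real ^ 'n) set" where
  "facet_pyramid c = (\<lambda>(i, s). {x. s * x $ i \<le> c \<and> (\<forall>j. \<bar>x $ j\<bar> \<le> s * x $ i)})"

text \<open>The mirror image of \<open>facet_pyramid c (i, s)\<close> in the hyperplane
  \<open>s * x $ i = c\<close>; for \<open>c > 0\<close> its apex is
  \<open>(2 * c * s) *\<^sub>R axis i 1\<close>.\<close>

definition facet_cap :: "real \<Rightarrow> 'n::finite \<times> real \<Rightarrow> (real ^ 'n) set" where
  "facet_cap c = (\<lambda>(i, s). {x. c \<le> s * x $ i \<and> s * x $ i \<le> 2 * c \<and>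
     (\<forall>j. j \<noteq> i \<longrightarrow> \<bar>x $ j\<bar> \<le> 2 * c - s * x $ i)})"

lemma finite_facets: "finite (facets :: ('n::finite \<times> real) set)"
  by (simp add: facets_def)

lemma mem_cube_iff: "x \<in> cbox (\<chi> i. - c) (\<chi> i. c) \<longleftrightarrow> (\<forall>i. \<bar>x $ i\<bar> \<le> c)"
  for x :: "real ^ 'n"
  by (auto simp: mem_box_cart abs_le_iff minus_le_iff)

lemma facet_pyramid_subset_cube: "facet_pyramid c p \<subseteq> cbox (\<chi> i. - c) (\<chi> i. c)"
  for p :: "'n::finite \<times> real"
proof
  fix x :: "real ^ 'n"
  assume x: "x \<in> facet_pyramid c p"
  have "\<bar>x $ j\<bar> \<le> c" for j
  proof -
    have "\<bar>x $ j\<bar> \<le> snd p * x $ fst p"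
      using x by (simp add: facet_pyramid_def split_beta)
    also have "\<dots> \<le> c"
      using x by (simp add: facet_pyramid_def split_beta)
    finally show ?thesis .
  qed
  then show "x \<in> cbox (\<chi> i. - c) (\<chi> i. c)"
    by (simp add: mem_cube_iff)
qed

lemma Union_facet_pyramid:
  "(\<Union>p\<in>facets. facet_pyramid c p) = (cbox (\<chi> i. - c) (\<chi> i. c) :: (real ^ 'n) set)"
proof -
  have "\<exists>p\<in>facets. x \<in> facet_pyramid c p" if "\<forall>i. \<bar>x $ i\<bar> \<le> c" for x :: "real ^ 'n"
  proof -
    \<comment> \<open>A coordinate of largest absolute value, together with its sign, selects the
      pyramid containing \<open>x\<close>.\<close>
    obtain k where "is_arg_max (\<lambda>j. \<bar>x $ j\<bar>) (\<lambda>_. True) k"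
      using ex_is_arg_min_if_finite[of UNIV "\<lambda>j. - \<bar>x $ j\<bar>"]
      by (auto simp: is_arg_min_def is_arg_max_def)
    then have k: "\<bar>x $ j\<bar> \<le> \<bar>x $ k\<bar>" for j
      by (auto simp: is_arg_max_def not_less)
    show ?thesis
    proof (cases "x $ k \<ge> 0")
      case True
      then show ?thesis
        using k that by (intro bexI[of _ "(k, 1)"]) (auto simp: facet_pyramid_def facets_def abs_le_iff)
    next
      case False
      then show ?thesis
        using k spec[OF that, of k]
        by (intro bexI[of _ "(k, -1)"]) (auto simp: facet_pyramid_def facets_def)
    qed
  qed
  then have "cbox (\<chi> i. - c) (\<chi> i. c) \<subseteq> (\<Union>p\<in>facets. facet_pyramid c p :: (real ^ 'n) set)"
    unfolding subset_iff mem_cube_iff UN_iff by blast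
  then show ?thesis
    by (intro subset_antisym UN_least facet_pyramid_subset_cube)
qed

text \<open>In dimension \<open>1\<close> the right-hand side has no constraint and is the whole line.\<close>

lemma Union_facet_cap:
  assumes "CARD('n) \<ge> 2"
  shows "cbox (\<chi> i. - c) (\<chi> i. c) \<union> (\<Union>p\<in>facets. facet_cap c p) =
         {x :: real ^ 'n. \<forall>i j. i \<noteq> j \<longrightarrow> \<bar>x $ i\<bar> + \<bar>x $ j\<bar> \<le> 2 * c}"
    (is "?L = ?R")
proof (intro subset_antisym subsetI)
  fix x :: "real ^ 'n"
  assume "x \<in> ?L"
  then have "(\<forall>i. \<bar>x $ i\<bar> \<le> c) \<or> (\<exists>p\<in>facets. x \<in> facet_cap c p)"
    by (simp add: mem_cube_iff)
  then show "x \<in> ?R"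
  proof (elim disjE bexE)
    assume "\<forall>i. \<bar>x $ i\<bar> \<le> c"
    then have "\<bar>x $ i\<bar> + \<bar>x $ j\<bar> \<le> c + c" for i j
      by (intro add_mono) blast+
    then show ?thesis
      unfolding mult_2 by blast
  next
    fix p :: "'n \<times> real"
    assume p: "p \<in> facets" "x \<in> facet_cap c p"
    obtain k s where ks: "p = (k, s)" "s \<in> {-1, 1}"
      using p by (auto simp: facets_def)
    with p have sx: "c \<le> s * x $ k" "s * x $ k \<le> 2 * c"
        "\<And>j. j \<noteq> k \<Longrightarrow> \<bar>x $ j\<bar> \<le> 2 * c - s * x $ k"
      by (simp_all add: facet_cap_def)
    have "\<bar>x $ k\<bar> = \<bar>s * x $ k\<bar>"
      using ks(2) by auto
    also have "\<dots> = s * x $ k"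
      using sx(1,2) by linarith
    finally have k: "c \<le> \<bar>x $ k\<bar>" "\<And>j. j \<noteq> k \<Longrightarrow> \<bar>x $ j\<bar> + \<bar>x $ k\<bar> \<le> 2 * c"
      using sx(1,3) by (simp_all add: le_diff_eq)
    \<comment> \<open>If neither index is \<open>k\<close>, both absolute values are at most
      \<open>2 * c - \<bar>x $ k\<bar>\<close>, hence at most \<open>c\<close>.\<close>
    have "\<bar>x $ i\<bar> + \<bar>x $ j\<bar> \<le> 2 * c" if "i \<noteq> j" for i j
      using k(1) k(2)[of i] k(2)[of j] that by (cases "i = k"; cases "j = k") auto
    then show ?thesis
      by blast
  qed
next
  fix x :: "real ^ 'n"
  assume x: "x \<in> ?R"
  show "x \<in> ?L"
  proof (cases "\<forall>i. \<bar>x $ i\<bar> \<le> c")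
    case True
    then show ?thesis
      by (simp add: mem_cube_iff)
  next
    case False
    then obtain k where k: "c < \<bar>x $ k\<bar>"
      by (auto simp: not_le)
    \<comment> \<open>The height bound \<open>\<bar>x $ k\<bar> \<le> 2 * c\<close> comes from
      pairing \<open>k\<close> with a second index, which exists because the dimension is at least
      2.\<close>
    have "UNIV \<noteq> {k}"
    proof
      assume "UNIV = {k}"
      then have "CARD('n) = 1"
        by (metis card.empty card_insert_disjoint empty_iff finite.emptyI One_nat_def)
      then show False
        using assms by simp
    qed
    then obtain l where "l \<noteq> k"
      by blast
    then have "\<bar>x $ k\<bar> + \<bar>x $ l\<bar> \<le> 2 * c"
      using x by auto
    then have le: "\<bar>x $ k\<bar> \<le> 2 * c"
      by linarith
    have others: "\<bar>x $ j\<bar> \<le> 2 * c - \<bar>x $ k\<bar>" if "j \<noteq> k" for j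
      using x that by (auto simp: le_diff_eq)
    define s :: real where "s = (if x $ k \<ge> 0 then 1 else -1)"
    have "s * x $ k = \<bar>x $ k\<bar>"
      by (auto simp: s_def)
    then have "x \<in> facet_cap c (k, s)"
      using k le others by (simp add: facet_cap_def)
    moreover have "(k, s) \<in> facets"
      by (simp add: facets_def s_def)
    ultimately show ?thesis
      by blast
  qed
qed

section \<open>Measurability, and equality of volumes by reflection\<close>

lemma closed_facet_pyramid: "closed (facet_pyramid c p)"
  by (cases p)
     (auto simp: facet_pyramid_def
           intro!: closed_Collect_conj closed_Collect_all closed_Collect_le continuous_intros)

lemma closed_facet_cap: "closed (facet_cap c p)"
  by (cases p)
     (auto simp: facet_cap_def imp_conv_disj
           intro!: closed_Collect_conj closed_Collect_all closed_Collect_disj closed_Collect_const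
                   closed_Collect_le continuous_intros)

lemma lmeasurable_facet_pyramid: "facet_pyramid c p \<in> lmeasurable"
  by (intro lmeasurable_compact compact_eq_bounded_closed[THEN iffD2] conjI closed_facet_pyramid
        bounded_subset[OF bounded_cbox facet_pyramid_subset_cube])

text \<open>The map is the reflection in the hyperplane \<open>x $ i = a / 2\<close>: an affine map
  with diagonal linear part and entries 1 or -1, so its Jacobian factor is 1.\<close>

lemma emeasure_reflect_coordinate:
  fixes A :: "(real ^ 'n) set"
  assumes "A \<in> sets borel"
  shows "emeasure lborel ((\<lambda>x. \<chi> j. if j = i then a - x $ j else x $ j) -` A) = emeasure lborel A"
proof -
  define d :: "real ^ 'n \<Rightarrow> real" where "d b = (if b = axis i 1 then -1 else 1)" for b
  define T where "T x = a *\<^sub>R axis i 1 + (\<Sum>b\<in>Basis. (d b * (x \<bullet> b)) *\<^sub>R b)" for x :: "real ^ 'n"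
  have T: "T = (\<lambda>x. \<chi> j. if j = i then a - x $ j else x $ j)"
  proof
    fix x
    have "T x $ k = (if k = i then a - x $ k else x $ k)" for k
    proof -
      have "T x $ k = T x \<bullet> axis k 1"
        by (simp add: inner_axis)
      also have "\<dots> = a * ((axis i 1 :: real ^ 'n) \<bullet> axis k 1) + d (axis k 1) * (x \<bullet> axis k 1)"
        unfolding T_def by (simp add: inner_add_left)
      finally show ?thesis
        by (simp add: d_def inner_axis axis_eq_axis) (simp add: axis_def)
    qed
    then show "T x = (\<chi> j. if j = i then a - x $ j else x $ j)"
      by (simp add: vec_eq_iff)
  qed
  have "lborel = density (distr lborel borel T) (\<lambda>_. \<Prod>b\<in>Basis. \<bar>d b\<bar>)"
    unfolding T_def by (intro lborel_affine_euclidean) (simp add: d_def)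
  also have "(\<Prod>b\<in>Basis. \<bar>d b\<bar>) = 1"
    by (intro prod.neutral) (simp add: d_def)
  finally have "lborel = distr lborel borel T"
    by (simp add: density_1)
  then have "emeasure lborel A = emeasure (distr lborel borel T) A"
    by simp
  also have "\<dots> = emeasure lborel (T -` A)"
    unfolding T_def using assms by (subst emeasure_distr) auto
  finally show ?thesis
    by (simp add: T)
qed

text \<open>As \<open>s * s = 1\<close>, the reflection replaces \<open>s * x $ i\<close> by
  \<open>2 * c - s * x $ i\<close>. This carries the height range from \<open>c\<close> to
  \<open>2 * c\<close> onto that from 0 to \<open>c\<close>, and the width bound
  \<open>2 * c - s * x $ i\<close> to \<open>s * x $ i\<close>.\<close>

lemma vimage_facet_cap:
  assumes "s \<in> {-1, 1}"
  shows "(\<lambda>x :: real ^ 'n. \<chi> j. if j = i then 2 * c * s - x $ j else x $ j) -` facet_cap c (i, s) =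
         facet_pyramid c (i, s)"
proof -
  have "s * (2 * c * s - t) = 2 * c - s * t" for t
    using assms by (auto simp: algebra_simps)
  \<comment> \<open>The pyramid hides its lower height bound in the case \<open>j = i\<close>,
    whereas the cap states its height bounds separately.\<close>
  moreover have "(\<forall>j. \<bar>x $ j\<bar> \<le> s * x $ i) \<longleftrightarrow>
      0 \<le> s * x $ i \<and> (\<forall>j. j \<noteq> i \<longrightarrow> \<bar>x $ j\<bar> \<le> s * x $ i)" for x :: "real ^ 'n"
  proof -
    have "\<bar>x $ i\<bar> \<le> s * x $ i \<longleftrightarrow> 0 \<le> s * x $ i"
      using assms by auto
    then show ?thesis
      by metis
  qed
  ultimately show ?thesis
    by (auto simp: facet_cap_def facet_pyramid_def set_eq_iff)
qed

lemma emeasure_facet_cap: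
  assumes "p \<in> facets"
  shows "emeasure lborel (facet_cap c p) = emeasure lborel (facet_pyramid c p)"
proof -
  obtain i s where p: "p = (i, s)" "s \<in> {-1, 1}"
    using assms by (auto simp: facets_def)
  show ?thesis
    using emeasure_reflect_coordinate[OF borel_closed[OF closed_facet_cap[of c p]], of i "2 * c * s"]
      p vimage_facet_cap[of s i c] by simp
qed

lemma
  assumes "p \<in> facets"
  shows measure_facet_cap: "measure lebesgue (facet_cap c p) = measure lebesgue (facet_pyramid c p)"
    and lmeasurable_facet_cap: "facet_cap c p \<in> lmeasurable"
proof -
  note [simp] = borel_closed[OF closed_facet_cap] borel_closed[OF closed_facet_pyramid]
  have "emeasure lebesgue (facet_cap c p) = emeasure lebesgue (facet_pyramid c p)"
    using emeasure_facet_cap[OF assms] by simp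
  then show "measure lebesgue (facet_cap c p) = measure lebesgue (facet_pyramid c p)"
      "facet_cap c p \<in> lmeasurable"
    using lmeasurable_facet_pyramid[of c p] unfolding measure_def fmeasurable_def by auto
qed

section \<open>Overlaps of the pieces are null sets\<close>

lemma negligible_facet_pyramid_Int:
  fixes p q :: "'n::finite \<times> real"
  assumes "p \<in> facets" "q \<in> facets" "p \<noteq> q"
  shows "negligible (facet_pyramid c p \<inter> facet_pyramid c q)"
proof -
  obtain i s j t where p: "p = (i, s)" "s \<in> {-1, 1}" and q: "q = (j, t)" "t \<in> {-1, 1}"
    using assms by (auto simp: facets_def)
  \<comment> \<open>This coordinate is \<open>s\<close> if \<open>i \<noteq> j\<close>; if
    \<open>i = j\<close> then \<open>t = - s\<close> and it is \<open>2 * s\<close>.\<close>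
  have "(s *\<^sub>R axis i 1 - t *\<^sub>R axis j 1 :: real ^ 'n) $ i \<noteq> 0"
    using p q assms(3) by (auto simp: axis_def)
  then have "s *\<^sub>R axis i 1 - t *\<^sub>R axis j 1 \<noteq> (0 :: real ^ 'n)"
    by (metis zero_index)
  then have "negligible {x :: real ^ 'n. (s *\<^sub>R axis i 1 - t *\<^sub>R axis j 1) \<bullet> x = 0}"
    by (intro negligible_hyperplane) simp
  moreover have "t * x $ j \<le> s * x $ i"
    if "x \<in> facet_pyramid c (i, s)" "t \<in> {-1, 1}" for x :: "real ^ 'n" and i j s t
  proof -
    have "t * x $ j \<le> \<bar>x $ j\<bar>"
      using that(2) by auto
    also have "\<dots> \<le> s * x $ i"
      using that(1) by (simp add: facet_pyramid_def)
    finally show ?thesis .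
  qed
  \<comment> \<open>Each side is the largest absolute value of a coordinate of \<open>x\<close>, so
    the overlap lies in a hyperplane through 0.\<close>
  then have "s * x $ i = t * x $ j"
    if "x \<in> facet_pyramid c p" "x \<in> facet_pyramid c q" for x :: "real ^ 'n"
    using that p q by (intro antisym) auto
  ultimately show ?thesis
    by (elim negligible_subset) (auto simp: inner_diff_left inner_axis')
qed

lemma negligible_facet_hyperplane:
  assumes "s \<noteq> 0"
  shows "negligible {x :: real ^ 'n. s * x $ i = b}"
proof -
  have "s *\<^sub>R axis i 1 \<noteq> (0 :: real ^ 'n)"
    using assms by simp
  then have "negligible {x :: real ^ 'n. (s *\<^sub>R axis i 1) \<bullet> x = b}"
    by (intro negligible_hyperplane) simp
  then show ?thesis
    by (simp add: inner_axis')
qed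

lemma negligible_facet_cap_Int:
  fixes p q :: "'n::finite \<times> real"
  assumes "c > 0" "p \<in> facets" "q \<in> facets" "p \<noteq> q"
  shows "negligible (facet_cap c p \<inter> facet_cap c q)"
proof -
  obtain i s j t where p: "p = (i, s)" "s \<in> {-1, 1}" and q: "q = (j, t)" "t \<in> {-1, 1}"
    using assms by (auto simp: facets_def)
  \<comment> \<open>Caps over opposite facets are disjoint because \<open>c > 0\<close>. For
    different axes, \<open>c \<le> \<bar>x $ j\<bar> \<le> 2 * c - s * x $ i \<le> c\<close> forces
    equality.\<close>
  have "s * x $ i = c" if "x \<in> facet_cap c p" "x \<in> facet_cap c q" for x :: "real ^ 'n"
  proof (cases "i = j")
    case True
    then show ?thesis
      using that p q assms by (auto simp: facet_cap_def)
  next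
    case False
    then have "c \<le> t * x $ j" "\<bar>x $ j\<bar> \<le> 2 * c - s * x $ i" "c \<le> s * x $ i"
      using that p q by (auto simp: facet_cap_def)
    moreover have "t * x $ j \<le> \<bar>x $ j\<bar>"
      using q by auto
    ultimately show ?thesis
      by linarith
  qed
  then have "facet_cap c p \<inter> facet_cap c q \<subseteq> {x. s * x $ i = c}"
    by blast
  with p show ?thesis
    by (intro negligible_subset[OF negligible_facet_hyperplane[of s i c]]) auto
qed

lemma negligible_cube_Int_facet_cap:
  fixes p :: "'n::finite \<times> real"
  assumes "p \<in> facets"
  shows "negligible (cbox (\<chi> i. - c) (\<chi> i. c) \<inter> facet_cap c p)"
proof -
  obtain i s where p: "p = (i, s)" "s \<in> {-1, 1}"
    using assms by (auto simp: facets_def)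
  have "s * x $ i = c" if "\<forall>i. \<bar>x $ i\<bar> \<le> c" "x \<in> facet_cap c p" for x :: "real ^ 'n"
  proof -
    have "s * x $ i \<le> \<bar>x $ i\<bar>"
      using p by auto
    also have "\<dots> \<le> c"
      using that(1) by blast
    finally show ?thesis
      using that(2) p by (simp add: facet_cap_def)
  qed
  then have "cbox (\<chi> i. - c) (\<chi> i. c) \<inter> facet_cap c p \<subseteq> {x. s * x $ i = c}"
    by (auto simp: mem_cube_iff)
  with p show ?thesis
    by (intro negligible_subset[OF negligible_facet_hyperplane[of s i c]]) auto
qed

section \<open>Volume of the body and its specialisation to the 24-cell\<close>

lemma
  assumes "c > 0" "CARD('n) \<ge> 2"
  defines "S \<equiv> {x :: real ^ 'n. \<forall>i j. i \<noteq> j \<longrightarrow> \<bar>x $ i\<bar> + \<bar>x $ j\<bar> \<le> 2 * c}"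
  shows lmeasurable_abs_pairs: "S \<in> lmeasurable"
    and measure_abs_pairs: "measure lebesgue S = 2 * (2 * c) ^ CARD('n)"
proof -
  let ?Q = "cbox (\<chi> i. - c) (\<chi> i. c) :: (real ^ 'n) set"
  let ?F = "facets :: ('n \<times> real) set"
  have S: "S = ?Q \<union> (\<Union>p\<in>?F. facet_cap c p)"
    unfolding S_def using Union_facet_cap assms(2) by blast
  have caps: "(\<Union>p\<in>?F. facet_cap c p) \<in> lmeasurable"
    by (intro fmeasurable.finite_UN finite_facets lmeasurable_facet_cap)
  then show "S \<in> lmeasurable"
    unfolding S by (intro fmeasurable.Un lmeasurable_cbox)
  have "?Q \<inter> (\<Union>p\<in>?F. facet_cap c p) = \<Union> ((\<lambda>p. ?Q \<inter> facet_cap c p) ` ?F)"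
    by blast
  also have "negligible \<dots>"
    using finite_facets negligible_cube_Int_facet_cap by (intro negligible_Union) auto
  finally have "measure lebesgue S = measure lebesgue ?Q + measure lebesgue (\<Union>p\<in>?F. facet_cap c p)"
    unfolding S
    using measure_Un3_negligible[of ?Q _ "{}"] caps by simp
  also have "measure lebesgue (\<Union>p\<in>?F. facet_cap c p) = (\<Sum>p\<in>?F. measure lebesgue (facet_cap c p))"
    by (intro measure_negligible_finite_Union_image finite_facets lmeasurable_facet_cap pairwiseI
        negligible_facet_cap_Int assms(1))
  \<comment> \<open>Each cap is exchanged for its pyramid, and the pyramids reassemble to the cube,
    so the caps contribute one further copy of its volume.\<close>
  also have "\<dots> = (\<Sum>p\<in>?F. measure lebesgue (facet_pyramid c p))"
    by (intro sum.cong refl measure_facet_cap)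
  also have "\<dots> = measure lebesgue (\<Union>p\<in>?F. facet_pyramid c p)"
    by (intro measure_negligible_finite_Union_image[symmetric] finite_facets
        lmeasurable_facet_pyramid pairwiseI negligible_facet_pyramid_Int)
  also have "(\<Union>p\<in>?F. facet_pyramid c p) = ?Q"
    by (rule Union_facet_pyramid)
  also have "measure lebesgue ?Q = (2 * c) ^ CARD('n)"
  proof -
    \<comment> \<open>The product formula for the content of a box requires the box to be
      nonempty.\<close>
    have "0 \<in> ?Q"
      using assms(1) by (simp add: mem_cube_iff)
    then show ?thesis
      by (subst measure_completion) (auto simp: content_cbox_if_cart)
  qed
  finally show "measure lebesgue S = 2 * (2 * c) ^ CARD('n)"
    by simp
qed

lemma cell_normalised_roots:
  assumes "bij_betw u {1..24} D4_normalised_roots"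
  shows "cell u = {x. \<forall>i j. i \<noteq> j \<longrightarrow> \<bar>x $ i\<bar> + \<bar>x $ j\<bar> \<le> sqrt 2}"
proof -
  have "cell u = {x. \<forall>r\<in>D4_normalised_roots. x \<bullet> r \<le> 1}"
    unfolding cell_def bij_betw_imp_surj_on[OF assms, symmetric] by auto
  also have "\<dots> = {x. \<forall>i j. i \<noteq> j \<longrightarrow>
      (\<forall>s t. s \<in> {-1, 1} \<and> t \<in> {-1, 1} \<longrightarrow> s * x $ i + t * x $ j \<le> sqrt 2)}"
  proof -
    have "x \<bullet> ((1 / sqrt 2) *\<^sub>R (s *\<^sub>R axis i 1 + t *\<^sub>R axis j 1)) \<le> 1 \<longleftrightarrow>
        s * x $ i + t * x $ j \<le> sqrt 2" for x :: "real ^ 4" and i j s t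
      by (simp add: inner_add_right inner_axis field_simps)
    then show ?thesis
      unfolding D4_normalised_roots_def D4_roots_def by blast
  qed
  also have "\<dots> = {x. \<forall>i j. i \<noteq> j \<longrightarrow> \<bar>x $ i\<bar> + \<bar>x $ j\<bar> \<le> sqrt 2}"
  proof -
    \<comment> \<open>The maximum over the signs is attained when both terms are nonnegative, so the
      four roots on a pair of axes merge into one inequality.\<close>
    have "(\<forall>s t. s \<in> {-1, 1} \<and> t \<in> {-1, 1} \<longrightarrow> s * a + t * b \<le> z) \<longleftrightarrow> \<bar>a\<bar> + \<bar>b\<bar> \<le> z"
      for a b z :: real
    proof -
      have "(\<forall>s t. s \<in> {-1, 1} \<and> t \<in> {-1, 1} \<longrightarrow> s * a + t * b \<le> z) \<longleftrightarrow>
          a + b \<le> z \<and> a - b \<le> z \<and> - a + b \<le> z \<and> - a - b \<le> z"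
        by (simp add: imp_conjL imp_disjL all_conj_distrib) auto
      then show ?thesis
        by (simp add: abs_if) linarith
    qed
    then show ?thesis
      by (simp only:)
  qed
  finally show ?thesis .
qed

lemma vol_cell_normalised_roots:
  assumes "bij_betw u {1..24} D4_normalised_roots"
  shows "vol (cell u) = 8"
proof -
  \<comment> \<open>Here \<open>c = sqrt 2 / 2\<close>: the cube has side \<open>sqrt 2\<close> and
    volume 4.\<close>
  have S: "cell u = {x. \<forall>i j. i \<noteq> j \<longrightarrow> \<bar>x $ i\<bar> + \<bar>x $ j\<bar> \<le> 2 * (sqrt 2 / 2)}"
    using cell_normalised_roots[OF assms] by simp
  have "sqrt 2 ^ (2 * 2) = 4"
    unfolding power_mult by simp
  then have "measure lebesgue (cell u) = 8"
    unfolding S by (subst measure_abs_pairs) auto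
  moreover have "cell u \<in> lmeasurable"
    unfolding S by (intro lmeasurable_abs_pairs) auto
  ultimately have "emeasure lebesgue (cell u) = 8"
    using emeasure_eq_measure2[of "cell u" lebesgue] by simp
  moreover have "vol (cell u) = emeasure lebesgue (cell u)"
    using borel_closed[OF closed_cell] by simp
  ultimately show ?thesis
    by simp
qed

theorem theorem7p1:
  fixes u \<eta> :: "nat \<Rightarrow> real ^ 4" and \<phi> :: "nat \<Rightarrow> real" and D :: "nat set"
  assumes "bij_betw u {1..24} D4_normalised_roots"
    and "D \<subseteq> {1..24}"
    and "\<And>j. j \<in> D \<Longrightarrow> norm (\<eta> j) = 1"
    and "\<And>j. j \<in> D \<Longrightarrow> \<eta> j \<bullet> u j = 0"
  shows "vol (cell (tilted u D \<phi> \<eta>)) =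
           vol (cell u) - vol (\<Union>j\<in>D. cap u (tilted u D \<phi> \<eta> j))
             + vol (\<Union>j\<in>D. cap (tilted u D \<phi> \<eta>) (u j))
       \<and> (vol (cell (tilted u D \<phi> \<eta>)) \<ge> 8 \<longleftrightarrow>
           vol (\<Union>j\<in>D. cap (tilted u D \<phi> \<eta>) (u j)) \<ge>
           vol (\<Union>j\<in>D. cap u (tilted u D \<phi> \<eta> j)))"
proof -
  let ?w = "tilted u D \<phi> \<eta>"
  let ?I = "vol (cell u \<inter> cell ?w)"
  let ?C = "vol (\<Union>j\<in>D. cap u (?w j))" and ?E = "vol (\<Union>j\<in>D. cap ?w (u j))"
  have V: "vol (cell u) = ?I + ?C"
    using assms(2) by (intro emeasure_cell_split) (auto simp: tilted_def)
  have W: "vol (cell ?w) = ?I + ?E"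
    using emeasure_cell_split[of D ?w u] assms(2) by (auto simp: tilted_def Int_commute)
  have eight: "?I + ?C = 8"
    using V vol_cell_normalised_roots[OF assms(1)] by simp
  \<comment> \<open>Finiteness of \<open>?C\<close> gives \<open>?I + ?C - ?C = ?I\<close> despite
    truncated subtraction; finiteness of \<open>?I\<close> permits its cancellation in the
    comparison with 8.\<close>
  then have "?I \<noteq> \<infinity>" "?C \<noteq> \<infinity>"
    by auto
  then show ?thesis
    unfolding V W eight[symmetric] by (simp add: ennreal_add_left_cancel_le)
qed

end
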